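(* Let $\mathcal{D}$ be a quasi-symmetric $t$-$(v,k,\lambda)$ design with $v \equiv 0 \pmod 8$, $k \equiv 0 \pmod 4$, and both block intersection numbers $x$ and $y$ even. Let $M$ be a block-by-point incidence matrix of $\mathcal{D}$ and let $C \subseteq \mathbb{F}_2^v$ be the binary linear code spanned by the rows of $M$. Then $C$ is contained in a doubly even self-dual binary linear code of length $v$.
   Context: A $t$-$(v,k,\lambda)$ design is a finite incidence structure $\mathcal{D}=(\mathcal{P},\mathcal{B},\mathcal{I})$ with disjoint sets $\mathcal{P}$ (points) and $\mathcal{B}$ (blocks), $\mathcal{I}\subseteq\mathcal{P}\times\mathcal{B}$, such that $|\mathcal{P}|=v$, every block is incident with exactly $k$ points, and every $t$ distinct points are incident with exactly $\lambda$ common blocks. Let $b=|\mathcal{B}|$. For $0\le s<k$, $s$ is a block intersection number of $\mathcal{D}$ if there are two blocks having exactly $s$ points in common. A design is quasi-symmetric if it has exactly two block intersection numbers, denoted $x<y$. The block-by-point incidence matrix is the $b\times v$ $0/1$ matrix with rows indexed by blocks, columns indexed by points, and entry $1$ exactly when the point is incident with the block; its entries are read in $\mathbb{F}_2$. A binary linear code is doubly even if all its codewords have Hamming weight divisible by $4$. A code $C$ is self-dual if $C=C^\perp$, with respect to the standard inner product. *)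

theory Defs
  imports "HOL-Library.Z2" "Jordan_Normal_Form.VS_Connect"
begin

text \<open>
  Points and blocks have separate types, so the point set and the block set are
  disjoint by typing. Distinct blocks may be incident with the same points.
\<close>

locale incidence_structure =
  fixes points :: "'p set" and blocks :: "'b set" and inc :: "('p \<times> 'b) set"
  assumes finite_points: "finite points"
    and finite_blocks: "finite blocks"
    and inc_subset: "inc \<subseteq> points \<times> blocks"
begin

definition pts :: "'b \<Rightarrow> 'p set" where
  "pts \<beta> = {p \<in> points. (p, \<beta>) \<in> inc}"

definition blks :: "'p set \<Rightarrow> 'b set" where
  "blks T = {\<beta> \<in> blocks. \<forall>p\<in>T. (p, \<beta>) \<in> inc}"

end

locale design = incidence_structure points blocks inc
  for t v k lam :: nat
    and points :: "'p set" and blocks :: "'b set" and inc :: "('p \<times> 'b) set" +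
  assumes card_points: "card points = v"
    and card_block: "\<beta> \<in> blocks \<Longrightarrow> card (pts \<beta>) = k"
    and balanced: "T \<subseteq> points \<Longrightarrow> card T = t \<Longrightarrow> card (blks T) = lam"
begin

definition is_intersection_number :: "nat \<Rightarrow> bool" where
  "is_intersection_number s \<longleftrightarrow>
     s < k \<and> (\<exists>\<beta>\<in>blocks. \<exists>\<gamma>\<in>blocks. \<beta> \<noteq> \<gamma> \<and> card (pts \<beta> \<inter> pts \<gamma>) = s)"

text \<open>
  \<open>M\<close> is an incidence matrix with respect to some numbering of the
  blocks (rows) and of the points (columns).
\<close>

definition is_incidence_matrix :: "bit mat \<Rightarrow> bool" where
  "is_incidence_matrix M \<longleftrightarrow>
     M \<in> carrier_mat (card blocks) v \<and>
     (\<exists>block point.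
        bij_betw block {..<card blocks} blocks \<and> bij_betw point {..<v} points \<and>
        (\<forall>i<card blocks. \<forall>j<v.
           M $$ (i, j) = (if (point j, block i) \<in> inc then 1 else 0)))"

end

locale quasi_symmetric_design = design t v k lam points blocks inc
  for t v k lam x y :: nat
    and points :: "'p set" and blocks :: "'b set" and inc :: "('p \<times> 'b) set" +
  assumes x_less_y: "x < y"
    and intersection_numbers: "{s. is_intersection_number s} = {x, y}"

definition linear_code :: "nat \<Rightarrow> bit vec set \<Rightarrow> bool" where
  "linear_code n C \<longleftrightarrow> VectorSpace.subspace class_ring C (module_vec TYPE(bit) n)"

definition hamming_weight :: "bit vec \<Rightarrow> nat" where
  "hamming_weight c = card {i. i < dim_vec c \<and> c $ i \<noteq> 0}"

definition doubly_even :: "bit vec set \<Rightarrow> bool" where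
  "doubly_even C \<longleftrightarrow> (\<forall>c\<in>C. 4 dvd hamming_weight c)"

definition self_dual :: "nat \<Rightarrow> bit vec set \<Rightarrow> bool" where
  "self_dual n C \<longleftrightarrow> C = vec_module.orthogonal_complement n C"

end

theory Submission
  imports Defs
begin

text \<open>
  Two blocks meet in \<open>x\<close>, \<open>y\<close> or \<open>k\<close> points, the last if they are incident with the same points,
  and all three numbers are even. Hence the rows of the incidence matrix are pairwise orthogonal
  vectors of weight \<open>k \<equiv> 0 (mod 4)\<close>. Everything else holds for any set \<open>R\<close> of pairwise orthogonal
  vectors of \<open>F\<^sub>2\<^sup>n\<close> with weights divisible by 4, where \<open>8\<close> divides \<open>n\<close>
  (\<open>doubly_even_self_dual_extension\<close>).

  The weight is almost additive: \<open>wt (u + w) = wt u + wt w - 2 |u \<inter> w|\<close>, and \<open>u \<bullet> w\<close> is the parity of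
  \<open>|u \<inter> w|\<close>. So a doubly even code \<open>D\<close> is contained in its dual \<open>D\<^sup>\<bottom>\<close>, and \<open>D \<union> (u + D)\<close> is again
  a doubly even code for every \<open>u \<in> D\<^sup>\<bottom>\<close> of weight divisible by 4 (\<open>doubly_even_extension\<close>). Take
  \<open>D\<close> maximal among the doubly even codes inside \<open>R\<^sup>\<bottom>\<close>. Maximality first puts every element of \<open>R\<close>
  into \<open>D\<close>; then \<open>D\<^sup>\<bottom> \<subseteq> R\<^sup>\<bottom>\<close>, so it also puts into \<open>D\<close> every element of \<open>D\<^sup>\<bottom>\<close> with weight
  divisible by 4.

  That such a \<open>D\<close> is self-dual follows by evaluating the Gauss sum
  \<open>S = \<Sum>u\<in>F\<^sub>2\<^sup>n. \<i>^(wt u)\<close> in two ways. The binomial theorem gives \<open>S = (1 + \<i>)^n = 16^(n/8)\<close>.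
  Averaging over translations by \<open>D\<close> multiplies the term of \<open>u\<close> by the mean of the character
  \<open>d \<mapsto> (-1)^(u \<bullet> d)\<close> of \<open>D\<close>, which vanishes unless \<open>u \<in> D\<^sup>\<bottom>\<close>; hence \<open>S\<close> equals the partial sum over
  \<open>D\<^sup>\<bottom>\<close> (\<open>gauss_sum_orthogonal_complement\<close>). The all-one vector is orthogonal to \<open>D\<close> and has weight
  \<open>n\<close>, so it lies in \<open>D\<close> and all weights in \<open>D\<^sup>\<bottom>\<close> are even. The terms of the partial sum are
  therefore \<open>1\<close> on \<open>D\<close> and \<open>-1\<close> on \<open>D\<^sup>\<bottom> - D\<close>, and
  \<open>|D| - |D\<^sup>\<bottom> - D| = 16^(n/8) > 0\<close>. But a nonempty \<open>D\<^sup>\<bottom> - D\<close> would contain a whole coset of \<open>D\<close>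
  and be at least as large as \<open>D\<close>.
\<close>

section \<open>Supports and weights of binary vectors\<close>

definition supp :: "bit vec \<Rightarrow> nat set" where
  "supp c = {i. i < dim_vec c \<and> c $ i \<noteq> 0}"

lemma hamming_weight_eq_card_supp: "hamming_weight c = card (supp c)"
  by (simp add: hamming_weight_def supp_def)

lemma finite_supp [simp]: "finite (supp c)"
  by (simp add: supp_def)

lemma supp_zero: "supp (0\<^sub>v n) = {}"
  by (auto simp: supp_def)

lemma supp_add:
  assumes "u \<in> carrier_vec n" "w \<in> carrier_vec n"
  shows "supp (u + w) = sym_diff (supp u) (supp w)"
  using assms by (auto simp: supp_def)

text \<open>
  The correction term is what makes the weight modulo 4 a quadratic function, polarizing to twice
  the scalar product.
\<close>

lemma hamming_weight_add:
  assumes "u \<in> carrier_vec n" "w \<in> carrier_vec n"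
  shows "hamming_weight (u + w) + 2 * card (supp u \<inter> supp w) = hamming_weight u + hamming_weight w"
proof -
  have "card (sym_diff (supp u) (supp w)) = card (supp u - supp w) + card (supp w - supp u)"
    by (intro card_Un_disjoint) auto
  moreover have "card (supp u) = card (supp u \<inter> supp w) + card (supp u - supp w)"
    by (simp add: card_Int_Diff)
  moreover have "card (supp w) = card (supp u \<inter> supp w) + card (supp w - supp u)"
    using card_Int_Diff[of "supp w" "supp u"] by (simp add: Int_commute)
  ultimately show ?thesis
    by (simp add: hamming_weight_eq_card_supp supp_add[OF assms])
qed

lemma scalar_prod_eq_0_iff_even:
  assumes "u \<in> carrier_vec n" "w \<in> carrier_vec n"
  shows "u \<bullet> w = 0 \<longleftrightarrow> even (card (supp u \<inter> supp w))"
proof -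
  have "u \<bullet> w = (\<Sum>i\<in>{0..<n}. of_bool (i \<in> supp u \<inter> supp w))"
    using assms by (auto simp: scalar_prod_def supp_def intro!: sum.cong)
  also have "\<dots> = of_nat (card ({0..<n} \<inter> {i. i \<in> supp u \<inter> supp w}))"
    by (subst sum_of_bool_eq) auto
  also have "{0..<n} \<inter> {i. i \<in> supp u \<inter> supp w} = supp u \<inter> supp w"
    using assms by (auto simp: supp_def)
  finally have "u \<bullet> w = of_nat (card (supp u \<inter> supp w))" .
  moreover have "b = 0 \<longleftrightarrow> even b" for b :: bit
    by (cases b) auto
  ultimately show ?thesis
    by (metis even_of_nat)
qed

lemma add_self_bit_vec:
  fixes u :: "bit vec"
  assumes "u \<in> carrier_vec n"
  shows "u + u = 0\<^sub>v n"
  using assms by (intro eq_vecI) auto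

lemma add_left_cancel_bit_vec:
  fixes u :: "bit vec"
  assumes "u \<in> carrier_vec n" "w \<in> carrier_vec n"
  shows "u + (u + w) = w"
  using assms by (metis add_self_bit_vec assoc_add_vec left_zero_vec)

lemma add_right_cancel_bit_vec:
  fixes u :: "bit vec"
  assumes "u \<in> carrier_vec n" "w \<in> carrier_vec n"
  shows "u + w + w = u"
  using assms by (metis add_self_bit_vec assoc_add_vec right_zero_vec)

lemma bij_betw_supp: "bij_betw supp (carrier_vec n) (Pow {..<n})"
proof (rule bij_betw_byWitness[where f' = "\<lambda>A. vec n (\<lambda>i. of_bool (i \<in> A))"])
  show "\<forall>c\<in>carrier_vec n. vec n (\<lambda>i. of_bool (i \<in> supp c)) = c"
    by (auto simp: supp_def intro!: eq_vecI)
  show "\<forall>A\<in>Pow {..<n}. supp (vec n (\<lambda>i. of_bool (i \<in> A))) = A"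
    by (auto simp: supp_def)
qed (auto simp: supp_def)

lemma finite_carrier_vec_bit: "finite (carrier_vec n :: bit vec set)"
  using bij_betw_finite[OF bij_betw_supp] by simp

section \<open>Linear codes\<close>

text \<open>
  The only scalars are \<open>0\<close> and \<open>1\<close>, so a linear code over the field with two elements is just an
  additive subgroup.
\<close>

lemma linear_code_iff:
  "linear_code n D \<longleftrightarrow>
     D \<subseteq> carrier_vec n \<and> 0\<^sub>v n \<in> D \<and> (\<forall>u\<in>D. \<forall>w\<in>D. u + w \<in> D)"
proof -
  interpret vec_space "TYPE(bit)" n .
  have smult: "a \<cdot>\<^sub>v u \<in> D"
    if "D \<subseteq> carrier_vec n" "0\<^sub>v n \<in> D" "u \<in> D" for a and u :: "bit vec"
    using that by (cases a) auto
  show ?thesis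
    unfolding linear_code_def VectorSpace.subspace_def submodule_def
    using vectorspace_axioms module_axioms smult
    by (auto simp: module_vec_simps)
qed

lemma translation_bij_linear_code:
  assumes "linear_code n D" "d \<in> D"
  shows "bij_betw (\<lambda>u. u + d) D D"
proof (rule bij_betw_byWitness[where f' = "\<lambda>u. u + d"])
  show "\<forall>u\<in>D. u + d + d = u" "\<forall>u\<in>D. u + d + d = u"
    using assms by (auto simp: linear_code_iff intro!: add_right_cancel_bit_vec)
qed (use assms in \<open>auto simp: linear_code_iff\<close>)

lemma linear_code_carrier: "linear_code n (carrier_vec n)"
  by (simp add: linear_code_iff)

lemma mem_orthogonal_complement_iff:
  "u \<in> vec_module.orthogonal_complement n D \<longleftrightarrow> u \<in> carrier_vec n \<and> (\<forall>w\<in>D. u \<bullet> w = 0)"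
  by (simp add: vec_module.orthogonal_complement_def)

lemma orthogonal_complement_add:
  fixes u w :: "bit vec"
  assumes "D \<subseteq> carrier_vec n"
    and "u \<in> vec_module.orthogonal_complement n D" "w \<in> vec_module.orthogonal_complement n D"
  shows "u + w \<in> vec_module.orthogonal_complement n D"
  using assms by (auto simp: mem_orthogonal_complement_iff subset_iff add_scalar_prod_distrib[of _ n])

text \<open>
  By \<open>hamming_weight_add\<close>, twice the size of the overlap of two codewords is a combination of three
  weights divisible by 4.
\<close>

lemma doubly_even_self_orthogonal:
  assumes "linear_code n D" "doubly_even D"
  shows "D \<subseteq> vec_module.orthogonal_complement n D"
proof -
  have "u \<bullet> w = 0" if "u \<in> D" "w \<in> D" for u w
  proof -
    have uw: "u \<in> carrier_vec n" "w \<in> carrier_vec n" "u + w \<in> D"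
      using assms that by (auto simp: linear_code_iff)
    have "4 dvd hamming_weight u" "4 dvd hamming_weight w" "4 dvd hamming_weight (u + w)"
      using assms that uw by (auto simp: doubly_even_def)
    then have "even (card (supp u \<inter> supp w))"
      using hamming_weight_add[OF uw(1,2)] by presburger
    then show ?thesis
      using scalar_prod_eq_0_iff_even uw by blast
  qed
  with assms show ?thesis
    by (auto simp: mem_orthogonal_complement_iff linear_code_iff)
qed

text \<open>
  Orthogonality of \<open>u\<close> to \<open>D\<close> makes the overlap of \<open>u\<close> with each codeword even, so that the weights
  in the coset \<open>u + D\<close> stay divisible by 4.
\<close>

lemma doubly_even_extension:
  assumes D: "linear_code n D" "doubly_even D"
    and u: "u \<in> vec_module.orthogonal_complement n D" "4 dvd hamming_weight u"
  shows "linear_code n (D \<union> (+) u ` D)" and "doubly_even (D \<union> (+) u ` D)"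
proof -
  have u_carrier: "u \<in> carrier_vec n"
    using u by (simp add: mem_orthogonal_complement_iff)
  have D_carrier: "\<And>d. d \<in> D \<Longrightarrow> d \<in> carrier_vec n"
    and D_add: "\<And>d e. d \<in> D \<Longrightarrow> e \<in> D \<Longrightarrow> d + e \<in> D"
    and D_zero: "0\<^sub>v n \<in> D"
    using D by (auto simp: linear_code_iff)
  have left: "d + (u + e) = u + (d + e)" if "d \<in> D" "e \<in> D" for d e
  proof -
    have "d \<in> carrier_vec n" "e \<in> carrier_vec n"
      using that D_carrier by auto
    then show ?thesis
      using assoc_add_vec[of d n u e] assoc_add_vec[of u n d e] comm_add_vec[of d n u] u_carrier
      by simp
  qed
  have right: "(u + d) + e = u + (d + e)" if "d \<in> D" "e \<in> D" for d e
    using that D_carrier u_carrier by (intro assoc_add_vec) auto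
  have cancel: "u + (u + d) = d" if "d \<in> D" for d
    using that D_carrier u_carrier by (intro add_left_cancel_bit_vec) auto
  show "linear_code n (D \<union> (+) u ` D)"
    unfolding linear_code_iff
    using u_carrier D_carrier D_add D_zero by (auto simp: left right cancel)
  have "4 dvd hamming_weight (u + d)" if "d \<in> D" for d
  proof -
    have d: "d \<in> carrier_vec n" "4 dvd hamming_weight d"
      using D that by (auto simp: linear_code_iff doubly_even_def)
    have "even (card (supp u \<inter> supp d))"
      using u that scalar_prod_eq_0_iff_even[OF u_carrier d(1)]
      by (simp add: mem_orthogonal_complement_iff)
    then show ?thesis
      using hamming_weight_add[OF u_carrier d(1)] d(2) u(2) by presburger
  qed
  then show "doubly_even (D \<union> (+) u ` D)"
    using D by (auto simp: doubly_even_def)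
qed

section \<open>The Gauss sum of the weight\<close>

lemma gauss_sum_carrier:
  fixes z :: "'a :: comm_ring_1"
  shows "(\<Sum>u\<in>carrier_vec n. z ^ hamming_weight u) = (1 + z) ^ n"
proof -
  have "(\<Sum>u\<in>carrier_vec n. z ^ hamming_weight u) = (\<Sum>A\<in>Pow {..<n}. z ^ card A)"
    unfolding hamming_weight_eq_card_supp
    by (rule sum.reindex_bij_betw[OF bij_betw_supp])
  also have "\<dots> = (\<Prod>i<n. z + 1)"
    by (subst prod_add) auto
  finally show ?thesis
    by (simp add: add.commute)
qed

text \<open>
  This is where the length has to be divisible by 8: \<open>1 + \<i>\<close> has argument \<open>\<pi>/4\<close>, so its eighth power
  is a positive real.
\<close>

lemma one_plus_i_power:
  assumes "8 dvd n"
  shows "(1 + \<i>) ^ n = of_nat (16 ^ (n div 8))"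
proof -
  have "(1 + \<i>) ^ 2 = 2 * \<i>"
    by (simp add: power2_eq_square algebra_simps)
  then have "((1 + \<i>) ^ 2) ^ 4 = 16"
    by (simp add: power_mult_distrib)
  then have "(1 + \<i>) ^ 8 = 16"
    by (simp flip: power_mult)
  moreover have "(1 + \<i>) ^ n = ((1 + \<i>) ^ 8) ^ (n div 8)"
    using assms by (simp flip: power_mult)
  ultimately show ?thesis
    by simp
qed

text \<open>
  Orthogonality of characters: if \<open>u \<bullet> e = 1\<close> for some codeword \<open>e\<close>, translation by \<open>e\<close> permutes \<open>D\<close>
  and negates every term.
\<close>

lemma sum_scalar_prod_sign:
  fixes u :: "bit vec"
  assumes D: "linear_code n D" and u: "u \<in> carrier_vec n"
  shows "(\<Sum>d\<in>D. if u \<bullet> d = 0 then 1 else - 1 :: complex) =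
    (if u \<in> vec_module.orthogonal_complement n D then of_nat (card D) else 0)"
proof (cases "u \<in> vec_module.orthogonal_complement n D")
  case True
  then show ?thesis
    by (simp add: mem_orthogonal_complement_iff)
next
  case False
  then obtain e where e: "e \<in> D" "u \<bullet> e \<noteq> 0"
    using u by (auto simp: mem_orthogonal_complement_iff)
  let ?S = "\<Sum>d\<in>D. if u \<bullet> d = 0 then 1 else - 1 :: complex"
  have "?S = (\<Sum>d\<in>D. if u \<bullet> (d + e) = 0 then 1 else - 1)"
    by (rule sum.reindex_bij_betw[OF translation_bij_linear_code[OF D e(1)], symmetric])
  also have "\<dots> = (\<Sum>d\<in>D. - (if u \<bullet> d = 0 then 1 else - 1))"
  proof (rule sum.cong[OF refl])
    fix d assume "d \<in> D"
    then have "u \<bullet> (d + e) = u \<bullet> d + u \<bullet> e"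
      using D u e by (intro scalar_prod_add_distrib) (auto simp: linear_code_iff)
    then show "(if u \<bullet> (d + e) = 0 then 1 else - 1) = (- (if u \<bullet> d = 0 then 1 else - 1) :: complex)"
      using e(2) by (cases "u \<bullet> d") auto
  qed
  also have "\<dots> = - ?S"
    by (simp only: sum_negf)
  finally have "?S = 0"
    by simp
  with False show ?thesis
    by simp
qed

text \<open>
  The full sum is invariant under translation by each \<open>d \<in> D\<close>. Summing the translates over \<open>D\<close> and
  exchanging the two sums attaches to each \<open>u\<close> a character sum over \<open>D\<close>.
\<close>

lemma gauss_sum_orthogonal_complement:
  assumes D: "linear_code n D" "doubly_even D"
  shows "(\<Sum>u\<in>carrier_vec n. \<i> ^ hamming_weight u) =
    (\<Sum>u\<in>vec_module.orthogonal_complement n D. \<i> ^ hamming_weight u)"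
proof -
  let ?V = "carrier_vec n :: bit vec set"
  let ?P = "vec_module.orthogonal_complement n D"
  let ?S = "\<Sum>u\<in>?V. \<i> ^ hamming_weight u"
  have fin: "finite D"
    using D finite_carrier_vec_bit finite_subset by (auto simp: linear_code_iff)
  have shift: "\<i> ^ hamming_weight (u + d) =
      \<i> ^ hamming_weight u * (if u \<bullet> d = 0 then 1 else - 1)" if "u \<in> ?V" "d \<in> D" for u d
  proof -
    have d: "d \<in> ?V" "4 dvd hamming_weight d"
      using D that by (auto simp: linear_code_iff doubly_even_def)
    let ?c = "card (supp u \<inter> supp d)" and ?s = "if u \<bullet> d = 0 then 1 else - 1 :: complex"
    have "\<i> ^ hamming_weight d = 1"
      using d(2) by (auto simp: power_mult elim!: dvdE)
    moreover have "\<i> ^ hamming_weight (u + d) * \<i> ^ (2 * ?c) =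
        \<i> ^ hamming_weight u * \<i> ^ hamming_weight d"
      by (simp only: hamming_weight_add[OF that(1) d(1)] flip: power_add)
    moreover have "\<i> ^ (2 * ?c) = ?s"
      using scalar_prod_eq_0_iff_even[OF that(1) d(1)] by (simp add: power_mult)
    ultimately have "\<i> ^ hamming_weight (u + d) * ?s = \<i> ^ hamming_weight u"
      by simp
    then have "\<i> ^ hamming_weight (u + d) * (?s * ?s) = \<i> ^ hamming_weight u * ?s"
      by (simp only: mult.assoc [symmetric])
    moreover have "?s * ?s = 1"
      by simp
    ultimately show ?thesis
      by (simp only: mult_1_right)
  qed
  have "of_nat (card D) * ?S = (\<Sum>d\<in>D. ?S)"
    by simp
  also have "\<dots> = (\<Sum>d\<in>D. \<Sum>u\<in>?V. \<i> ^ hamming_weight (u + d))"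
  proof (rule sum.cong[OF refl])
    fix d assume "d \<in> D"
    then have "d \<in> ?V"
      using D by (auto simp: linear_code_iff)
    then show "?S = (\<Sum>u\<in>?V. \<i> ^ hamming_weight (u + d))"
      by (rule sum.reindex_bij_betw[OF translation_bij_linear_code[OF linear_code_carrier], symmetric])
  qed
  also have "\<dots> = (\<Sum>u\<in>?V. \<Sum>d\<in>D. \<i> ^ hamming_weight (u + d))"
    by (rule sum.swap)
  also have "\<dots> = (\<Sum>u\<in>?V. \<i> ^ hamming_weight u * (\<Sum>d\<in>D. if u \<bullet> d = 0 then 1 else - 1))"
    by (simp add: shift sum_distrib_left)
  also have "\<dots> = (\<Sum>u\<in>?V. if u \<in> ?P then of_nat (card D) * \<i> ^ hamming_weight u else 0)"
    by (rule sum.cong[OF refl]) (simp add: sum_scalar_prod_sign[OF D(1)])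
  also have "\<dots> = (\<Sum>u\<in>?V \<inter> ?P. of_nat (card D) * \<i> ^ hamming_weight u)"
    using finite_carrier_vec_bit by (simp add: sum.inter_restrict)
  also have "?V \<inter> ?P = ?P"
    by (auto simp: mem_orthogonal_complement_iff)
  finally have "of_nat (card D) * ?S = of_nat (card D) * (\<Sum>u\<in>?P. \<i> ^ hamming_weight u)"
    by (simp add: sum_distrib_left)
  moreover have "card D \<noteq> 0"
    using fin D by (auto simp: linear_code_iff)
  ultimately show ?thesis
    by simp
qed

section \<open>Doubly even self-dual codes\<close>

text \<open>
  The two evaluations of the Gauss sum show that \<open>D\<close> has strictly more elements than the rest of its
  dual, while one further element of the dual would bring its whole coset along.
\<close>

lemma doubly_even_self_dual_if_saturated:
  assumes D: "linear_code n D" "doubly_even D" and n: "8 dvd n"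
    and saturated: "\<And>u. u \<in> vec_module.orthogonal_complement n D \<Longrightarrow> 4 dvd hamming_weight u \<Longrightarrow> u \<in> D"
  shows "self_dual n D"
proof (rule ccontr)
  let ?P = "vec_module.orthogonal_complement n D"
  assume "\<not> self_dual n D"
  have sub: "D \<subseteq> ?P"
    by (rule doubly_even_self_orthogonal[OF D])
  with \<open>\<not> self_dual n D\<close> obtain u where u: "u \<in> ?P" "u \<notin> D"
    by (auto simp: self_dual_def)
  have carrier: "?P \<subseteq> carrier_vec n"
    by (auto simp: mem_orthogonal_complement_iff)
  have fin: "finite ?P"
    using carrier finite_carrier_vec_bit finite_subset by blast
  then have finD: "finite D"
    using sub finite_subset by blast
  have even_weight: "even (hamming_weight w)" if "w \<in> ?P" for w
  proof -
    \<comment> \<open>The parity of \<open>wt w\<close> is the scalar product of \<open>w\<close> with the all-one vector, which belongs to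
      \<open>D\<close> by saturation.\<close>
    let ?one = "vec n (\<lambda>_. 1 :: bit)"
    have supp_one: "supp ?one = {..<n}"
      by (auto simp: supp_def)
    have inter: "supp ?one \<inter> supp c = supp c" "supp c \<inter> supp ?one = supp c"
      if "c \<in> carrier_vec n" for c
      using that unfolding supp_one by (auto simp: supp_def)
    have "?one \<bullet> d = 0" if "d \<in> D" for d
    proof -
      have "d \<in> carrier_vec n" "4 dvd hamming_weight d"
        using D that by (auto simp: linear_code_iff doubly_even_def)
      then show ?thesis
        using scalar_prod_eq_0_iff_even[of ?one n d] dvd_trans[of 2 4 "card (supp d)"]
        by (simp add: inter hamming_weight_eq_card_supp)
    qed
    moreover have "4 dvd hamming_weight ?one"
      using n by (simp add: hamming_weight_eq_card_supp supp_one) presburger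
    ultimately have "?one \<in> D"
      by (intro saturated) (auto simp: mem_orthogonal_complement_iff)
    then have "w \<bullet> ?one = 0" "w \<in> carrier_vec n"
      using that by (auto simp: mem_orthogonal_complement_iff)
    then show ?thesis
      using scalar_prod_eq_0_iff_even[of w n ?one]
      by (simp add: inter hamming_weight_eq_card_supp)
  qed
  have i_outside: "\<i> ^ hamming_weight w = - 1" if w: "w \<in> ?P" "w \<notin> D" for w
  proof -
    have wc: "w \<in> carrier_vec n" "even (hamming_weight w)"
      using w carrier even_weight by auto
    then obtain m where m: "hamming_weight w = 2 * m"
      by blast
    have "\<not> 4 dvd hamming_weight w"
      using saturated w by blast
    then have "odd m"
      using m by presburger
    then show ?thesis
      by (simp add: m power_mult)
  qed
  have i_inside: "\<i> ^ hamming_weight d = 1" if "d \<in> D" for d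
    using D(2) that by (auto simp: doubly_even_def power_mult elim!: dvdE dest!: bspec)
  have "of_nat (16 ^ (n div 8)) = (\<Sum>w\<in>?P. \<i> ^ hamming_weight w)"
    using one_plus_i_power[OF n] gauss_sum_carrier[where z = \<i> and n = n]
      gauss_sum_orthogonal_complement[OF D] by simp
  also have "\<dots> = (\<Sum>w\<in>?P - D. \<i> ^ hamming_weight w) + (\<Sum>w\<in>D. \<i> ^ hamming_weight w)"
    by (rule sum.subset_diff[OF sub fin])
  also have "\<dots> = of_nat (card D) - of_nat (card (?P - D))"
    by (simp add: i_outside i_inside)
  finally have "(of_nat (16 ^ (n div 8) + card (?P - D)) :: complex) = of_nat (card D)"
    by simp
  then have "16 ^ (n div 8) + card (?P - D) = card D"
    by (simp only: of_nat_eq_iff)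
  then have "card (?P - D) < card D"
    by (metis less_add_same_cancel2 zero_less_numeral zero_less_power)
  moreover have "card D \<le> card (?P - D)"
  proof (rule card_inj_on_le[where f = "\<lambda>d. u + d"])
    have cancel: "u + (u + d) = d" if "d \<in> D" for d
      using that sub carrier u(1) by (intro add_left_cancel_bit_vec) auto
    then show "inj_on (\<lambda>d. u + d) D"
      by (metis inj_onI)
    have "u + d \<in> ?P" if "d \<in> D" for d
      using that sub u D orthogonal_complement_add by (auto simp: linear_code_iff)
    moreover have "u + d \<notin> D" if "d \<in> D" for d
    proof
      assume "u + d \<in> D"
      then have "(u + d) + d \<in> D"
        using D that by (auto simp: linear_code_iff)
      moreover have "(u + d) + d = u"
        using that sub carrier u(1) by (intro add_right_cancel_bit_vec) auto
      ultimately show False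
        using u(2) by simp
    qed
    ultimately show "(\<lambda>d. u + d) ` D \<subseteq> ?P - D"
      by blast
  qed (use fin in auto)
  ultimately show False
    by simp
qed

text \<open>
  Maximality is taken inside \<open>R\<^sup>\<bottom>\<close> rather than among codes containing \<open>R\<close>: this family visibly has a
  member, the zero code, and adjoining an element of \<open>R\<close> does not leave it. Once \<open>R \<subseteq> D\<close> is
  known, nothing is lost, since every vector orthogonal to \<open>D\<close> lies in \<open>R\<^sup>\<bottom>\<close>.
\<close>

theorem doubly_even_self_dual_extension:
  assumes R: "R \<subseteq> carrier_vec n" and n: "8 dvd n"
    and weight: "\<And>r. r \<in> R \<Longrightarrow> 4 dvd hamming_weight r"
    and orth: "\<And>r s. r \<in> R \<Longrightarrow> s \<in> R \<Longrightarrow> r \<bullet> s = 0"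
  shows "\<exists>D. linear_code n D \<and> doubly_even D \<and> self_dual n D \<and> R \<subseteq> D"
proof -
  let ?P = "vec_module.orthogonal_complement n R"
  let ?F = "{D. linear_code n D \<and> doubly_even D \<and> D \<subseteq> ?P}"
  have "?F \<subseteq> Pow (carrier_vec n)"
    by (auto simp: linear_code_iff)
  then have "finite ?F"
    using finite_carrier_vec_bit finite_subset by blast
  moreover have "{0\<^sub>v n} \<in> ?F"
    using R by (auto simp: linear_code_iff doubly_even_def hamming_weight_eq_card_supp
        supp_zero mem_orthogonal_complement_iff)
  ultimately have "\<exists>D\<in>?F. \<forall>E\<in>?F. D \<subseteq> E \<longrightarrow> D = E"
    by (intro finite_has_maximal) auto
  then obtain D where D: "D \<in> ?F" and max: "\<And>E. E \<in> ?F \<Longrightarrow> D \<subseteq> E \<Longrightarrow> D = E"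
    by (elim bexE) simp
  have absorb: "u \<in> D"
    if u: "u \<in> vec_module.orthogonal_complement n D" "4 dvd hamming_weight u" "u \<in> ?P" for u
  proof -
    have "D \<union> (+) u ` D \<in> ?F"
      using D doubly_even_extension[OF _ _ u(1,2)] orthogonal_complement_add[OF R u(3)] by auto
    then have "D = D \<union> (+) u ` D"
      using max by blast
    moreover have "u + 0\<^sub>v n = u" "0\<^sub>v n \<in> D"
      using u D by (auto simp: mem_orthogonal_complement_iff linear_code_iff)
    ultimately show ?thesis
      by (metis UnI2 image_eqI)
  qed
  have "R \<subseteq> D"
  proof
    fix r assume r: "r \<in> R"
    have "r \<bullet> d = 0" if "d \<in> D" for d
    proof -
      have "d \<in> carrier_vec n" "d \<bullet> r = 0" "r \<in> carrier_vec n"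
        using D that r R by (auto simp: mem_orthogonal_complement_iff)
      then show ?thesis
        by (metis comm_scalar_prod)
    qed
    then show "r \<in> D"
      using r R weight orth by (intro absorb) (auto simp: mem_orthogonal_complement_iff)
  qed
  moreover have "self_dual n D"
  proof (rule doubly_even_self_dual_if_saturated[OF _ _ n])
    fix u assume "u \<in> vec_module.orthogonal_complement n D" "4 dvd hamming_weight u"
    then show "u \<in> D"
      using \<open>R \<subseteq> D\<close> by (intro absorb) (auto simp: mem_orthogonal_complement_iff)
  qed (use D in auto)
  ultimately show ?thesis
    using D by blast
qed

lemma row_space_subset_linear_code:
  fixes M :: "bit mat"
  assumes "linear_code n D" "set (rows M) \<subseteq> D"
  shows "vec_space.row_space n M \<subseteq> D"
proof -
  interpret vec_space "TYPE(bit)" n .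
  have "submodule class_ring D V"
    using assms(1) by (simp add: linear_code_def VectorSpace.subspace_def)
  with assms(2) show ?thesis
    unfolding row_space_def by (rule span_is_subset)
qed

section \<open>Incidence matrices of quasi-symmetric designs\<close>

text \<open>
  Two blocks with \<open>k\<close> common points, possibly equal, do not produce a block intersection number; for
  them the parity of \<open>k\<close> is used.
\<close>

lemma (in quasi_symmetric_design) even_card_pts_inter:
  assumes "even k" "even x" "even y" and "\<beta> \<in> blocks" "\<gamma> \<in> blocks"
  shows "even (card (pts \<beta> \<inter> pts \<gamma>))"
proof (cases "card (pts \<beta> \<inter> pts \<gamma>) < k \<and> \<beta> \<noteq> \<gamma>")
  case True
  then have "is_intersection_number (card (pts \<beta> \<inter> pts \<gamma>))"
    using assms by (auto simp: is_intersection_number_def)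
  then have "card (pts \<beta> \<inter> pts \<gamma>) \<in> {x, y}"
    using intersection_numbers by blast
  then show ?thesis
    using assms by auto
next
  case False
  have "finite (pts \<beta>)"
    using finite_points by (simp add: pts_def)
  then have "card (pts \<beta> \<inter> pts \<gamma>) \<le> k"
    using card_block[OF assms(4)] card_mono[of "pts \<beta>" "pts \<beta> \<inter> pts \<gamma>"] by simp
  then have "card (pts \<beta> \<inter> pts \<gamma>) = k"
    using False card_block[OF assms(4)] by auto
  then show ?thesis
    using assms by simp
qed

text \<open>
  The numbering of the points identifies coordinates with points injectively, so weights and overlaps
  of rows can be counted as sizes of point sets of blocks.
\<close>

lemma (in design) incidence_matrix_rowsE:
  assumes "is_incidence_matrix M"
  obtains point where "bij_betw point {..<v} points"
    and "\<And>r. r \<in> set (rows M) \<Longrightarrow> \<exists>\<beta>\<in>blocks. r \<in> carrier_vec v \<and> point ` supp r = pts \<beta>"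
proof -
  obtain block point where M: "M \<in> carrier_mat (card blocks) v"
    and block: "bij_betw block {..<card blocks} blocks"
    and point: "bij_betw point {..<v} points"
    and entries: "\<And>i j. i < card blocks \<Longrightarrow> j < v \<Longrightarrow>
      M $$ (i, j) = (if (point j, block i) \<in> inc then 1 else 0)"
    using assms unfolding is_incidence_matrix_def by blast
  have "\<exists>\<beta>\<in>blocks. r \<in> carrier_vec v \<and> point ` supp r = pts \<beta>" if "r \<in> set (rows M)" for r
  proof -
    obtain i where "i < length (rows M)" "rows M ! i = r"
      using \<open>r \<in> set (rows M)\<close> unfolding in_set_conv_nth by blast
    then have i: "i < card blocks" "r = row M i"
      using M by auto
    have "supp r = {j \<in> {..<v}. (point j, block i) \<in> inc}"
      using i M entries by (auto simp: supp_def split: if_splits)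
    then have "point ` supp r = {p \<in> point ` {..<v}. (p, block i) \<in> inc}"
      by blast
    also have "point ` {..<v} = points"
      using point by (simp add: bij_betw_def)
    finally have "point ` supp r = pts (block i)"
      by (simp only: pts_def)
    moreover have "r \<in> carrier_vec v"
      unfolding i(2) by (rule row_carrier_vec[OF i(1) M])
    moreover have "block i \<in> blocks"
      using bij_betwE[OF block] i(1) by simp
    ultimately show ?thesis
      by blast
  qed
  then show thesis
    by (rule that[OF point])
qed

theorem theorem3p1:
  fixes t v k lam x y :: nat
    and points :: "'p set" and blocks :: "'b set" and inc :: "('p \<times> 'b) set"
    and M :: "bit mat" and C :: "bit vec set"
  assumes "quasi_symmetric_design t v k lam x y points blocks inc"
    and "v mod 8 = 0"
    and "k mod 4 = 0"
    and "even x" and "even y"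
    and "design.is_incidence_matrix v points blocks inc M"
    and "C = vec_space.row_space v M"
  shows "\<exists>D. linear_code v D \<and> doubly_even D \<and> self_dual v D \<and> C \<subseteq> D"
proof -
  interpret quasi_symmetric_design t v k lam x y points blocks inc
    by fact
  obtain point where point: "bij_betw point {..<v} points"
    and rows: "\<And>r. r \<in> set (rows M) \<Longrightarrow> \<exists>\<beta>\<in>blocks. r \<in> carrier_vec v \<and> point ` supp r = pts \<beta>"
    using incidence_matrix_rowsE[OF assms(6)] by blast
  have inj: "inj_on point {..<v}"
    using point by (simp add: bij_betw_def)
  have supp_sub: "supp r \<subseteq> {..<v}" if "r \<in> set (rows M)" for r
    using rows[OF that] by (auto simp: supp_def)
  have "even k"
    using assms(3) by presburger
  have "\<exists>D. linear_code v D \<and> doubly_even D \<and> self_dual v D \<and> set (rows M) \<subseteq> D"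
  proof (rule doubly_even_self_dual_extension)
    show "set (rows M) \<subseteq> carrier_vec v"
      using rows by blast
    show "8 dvd v"
      using assms(2) by presburger
  next
    fix r assume r: "r \<in> set (rows M)"
    then obtain \<beta> where \<beta>: "\<beta> \<in> blocks" "point ` supp r = pts \<beta>"
      using rows by blast
    have "hamming_weight r = card (point ` supp r)"
      using inj_on_subset[OF inj supp_sub[OF r]]
      by (simp add: hamming_weight_eq_card_supp card_image)
    then have "hamming_weight r = k"
      using \<beta> card_block by simp
    then show "4 dvd hamming_weight r"
      using assms(3) by presburger
  next
    fix r s assume r: "r \<in> set (rows M)" and s: "s \<in> set (rows M)"
    obtain \<beta> where \<beta>: "\<beta> \<in> blocks" "point ` supp r = pts \<beta>" "r \<in> carrier_vec v"
      using rows[OF r] by blast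
    obtain \<gamma> where \<gamma>: "\<gamma> \<in> blocks" "point ` supp s = pts \<gamma>" "s \<in> carrier_vec v"
      using rows[OF s] by blast
    have "card (supp r \<inter> supp s) = card (point ` (supp r \<inter> supp s))"
      using inj_on_subset[OF inj] supp_sub[OF r] by (metis card_image le_infI1)
    also have "point ` (supp r \<inter> supp s) = pts \<beta> \<inter> pts \<gamma>"
      using inj_on_image_Int[OF inj supp_sub[OF r] supp_sub[OF s]] \<beta> \<gamma> by simp
    finally show "r \<bullet> s = 0"
      using even_card_pts_inter[OF \<open>even k\<close> assms(4,5) \<beta>(1) \<gamma>(1)]
        scalar_prod_eq_0_iff_even[OF \<beta>(3) \<gamma>(3)] by simp
  qed
  then show ?thesis
    using row_space_subset_linear_code assms(7) by blast
qed

end
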